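(* $\mathrm{rc}_2(K_{2,4,16})=2$.
   Context: Given an edge coloring $c:E(G)\to[\ell]$, a path is rainbow if no two of its edges receive the same color. $(G,c)$ is rainbow $k$-connected if every pair of distinct vertices is joined by $k$ pairwise internally disjoint rainbow paths. The rainbow $k$-connection number $\mathrm{rc}_k(G)$ is the minimum $\ell$ such that some coloring $c:E(G)\to[\ell]$ makes $(G,c)$ rainbow $k$-connected. $K_{2,4,16}$ denotes the complete tripartite graph with parts of sizes $2,4,16$. *)

theory Defs
  imports Main "HOL-Library.Extended_Nat"
begin

text \<open>A simple graph is represented by a pair \<open>(V, E)\<close> whose edges are two-element
  subsets of \<open>V\<close>; the type does not enforce this.\<close>

type_synonym 'a graph = "'a set \<times> 'a set set"

abbreviation verts :: "'a graph \<Rightarrow> 'a set" where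
  "verts \<equiv> fst"

abbreviation edges :: "'a graph \<Rightarrow> 'a set set" where
  "edges \<equiv> snd"

text \<open>Paths are given by their lists of vertices, which determines them in a simple graph.\<close>

fun path_edges :: "'a list \<Rightarrow> 'a set list" where
  "path_edges (x # y # xs) = {x, y} # path_edges (y # xs)"
| "path_edges _ = []"

definition path_between :: "'a graph \<Rightarrow> 'a \<Rightarrow> 'a \<Rightarrow> 'a list \<Rightarrow> bool" where
  "path_between G u v p \<longleftrightarrow>
     p \<noteq> [] \<and> hd p = u \<and> last p = v \<and> distinct p \<and>
     set p \<subseteq> verts G \<and> set (path_edges p) \<subseteq> edges G"

definition rainbow :: "('a set \<Rightarrow> nat) \<Rightarrow> 'a list \<Rightarrow> bool" where
  "rainbow c p \<longleftrightarrow> distinct (map c (path_edges p))"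

definition inner_verts :: "'a list \<Rightarrow> 'a set" where
  "inner_verts p = set (butlast (tl p))"

definition rainbow_connected :: "nat \<Rightarrow> 'a graph \<Rightarrow> ('a set \<Rightarrow> nat) \<Rightarrow> bool" where
  "rainbow_connected k G c \<longleftrightarrow>
     (\<forall>u \<in> verts G. \<forall>v \<in> verts G. u \<noteq> v \<longrightarrow>
        (\<exists>P. finite P \<and> card P = k \<and>
             (\<forall>p \<in> P. path_between G u v p \<and> rainbow c p) \<and>
             (\<forall>p \<in> P. \<forall>q \<in> P. p \<noteq> q \<longrightarrow> inner_verts p \<inter> inner_verts q = {})))"

text \<open>The infimum is a minimum whenever some colouring is rainbow \<open>k\<close>-connected; otherwise it
  is \<open>\<infinity>\<close>.\<close>

definition rc :: "nat \<Rightarrow> 'a graph \<Rightarrow> enat" where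
  "rc k G = Inf {enat l | l. \<exists>c. c ` edges G \<subseteq> {1..l} \<and> rainbow_connected k G c}"

text \<open>The vertex \<open>(i, j)\<close> is the \<open>j\<close>-th vertex of the \<open>i\<close>-th part, which has size \<open>ns ! i\<close>.\<close>

definition complete_multipartite :: "nat list \<Rightarrow> (nat \<times> nat) graph" where
  "complete_multipartite ns =
     (let V = {(i, j). i < length ns \<and> j < ns ! i}
      in (V, {{x, y} | x y. x \<in> V \<and> y \<in> V \<and> fst x \<noteq> fst y}))"

end

theory Submission
  imports Defs
begin

text \<open>With two colours a rainbow path has at most two edges, so a colouring is rainbow
  2-connected as soon as every non-adjacent pair has two, and every adjacent pair one, common
  neighbour joined to its ends in different colours. Give every edge between the parts of sizes 2
  and 4 the light colour, and encode the vertices of the part of size 16 by their vectors of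
  colours towards the other two parts: take all pairs of a unit vector in \<open>{0,1}\<^sup>2\<close> and a vector
  of odd weight in \<open>{0,1}\<^sup>4\<close>. All these 16 words have the same parity, so any two
  of them differ in two places; and as neither component vanishes, each vertex sends a heavy
  edge to both small parts, which serves the adjacent pairs. Conversely, one colour
  only admits the single edge as a rainbow path.\<close>

lemma length_path_edges: "length (path_edges p) = length p - 1"
  by (induction p rule: path_edges.induct) auto

text \<open>Each colour occurs at most once on a rainbow path, so there are at most \<open>l\<close>
  edges; a path has one vertex more than edges.\<close>

lemma rainbow_length_le:
  assumes "path_between G u v p" "rainbow c p" "c ` edges G \<subseteq> {1..l}"
  shows "length p \<le> Suc l"
proof -
  have "set (map c (path_edges p)) \<subseteq> {1..l}"
    using assms(1,3) by (auto simp: path_between_def)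
  then have "card (set (map c (path_edges p))) \<le> l"
    using card_mono[of "{1..l}"] by simp
  then have "length (path_edges p) \<le> l"
    using assms(2) distinct_card by (fastforce simp: rainbow_def)
  then show ?thesis
    by (simp add: length_path_edges)
qed

lemma path_between_length_le_2:
  assumes "path_between G u v p" "u \<noteq> v" "length p \<le> 2"
  shows "p = [u, v]"
proof (cases p rule: path_edges.cases)
  case (1 x y xs)
  then show ?thesis using assms by (auto simp: path_between_def)
qed (use assms in \<open>auto simp: path_between_def\<close>)

lemma rainbow_2_connected_imp_2_colours:
  assumes c: "c ` edges G \<subseteq> {1..l}" and conn: "rainbow_connected 2 G c"
    and uv: "u \<in> verts G" "v \<in> verts G" "u \<noteq> v"
  shows "2 \<le> l"
proof (rule ccontr)
  assume l: "\<not> 2 \<le> l"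
  obtain P where P: "card P = 2" "\<forall>p\<in>P. path_between G u v p \<and> rainbow c p"
    using conn uv unfolding rainbow_connected_def by blast
  have "p = [u, v]" if "p \<in> P" for p
    using path_between_length_le_2[of G u v p] rainbow_length_le[of G u v p c l] P(2) that l c uv
    by fastforce
  then have "P \<subseteq> {[u, v]}" by blast
  then have "card P \<le> card {[u, v]}" by (intro card_mono) auto
  with P(1) show False by simp
qed

definition rainbow_mids :: "'a graph \<Rightarrow> ('a set \<Rightarrow> nat) \<Rightarrow> 'a \<Rightarrow> 'a \<Rightarrow> 'a set" where
  "rainbow_mids G c u v =
     {w \<in> verts G - {u, v}. {u, w} \<in> edges G \<and> {w, v} \<in> edges G \<and> c {u, w} \<noteq> c {w, v}}"

lemma rainbow_path_mid:
  assumes "w \<in> rainbow_mids G c u v" "u \<in> verts G" "v \<in> verts G" "u \<noteq> v"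
  shows "path_between G u v [u, w, v]" "rainbow c [u, w, v]"
  using assms by (auto simp: rainbow_mids_def path_between_def rainbow_def)

text \<open>For an adjacent pair the edge itself is one of the two paths: having no inner vertex, it
  is disjoint inside from any other. Paths of length two are disjoint inside once their midpoints
  differ.\<close>

lemma rainbow_2_connectedI:
  assumes adj: "\<And>u v. u \<in> verts G \<Longrightarrow> v \<in> verts G \<Longrightarrow> u \<noteq> v \<Longrightarrow> {u, v} \<in> edges G \<Longrightarrow>
      \<exists>w. w \<in> rainbow_mids G c u v"
    and nonadj: "\<And>u v. u \<in> verts G \<Longrightarrow> v \<in> verts G \<Longrightarrow> u \<noteq> v \<Longrightarrow> {u, v} \<notin> edges G \<Longrightarrow>
      \<exists>w w'. w \<noteq> w' \<and> w \<in> rainbow_mids G c u v \<and> w' \<in> rainbow_mids G c u v"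
  shows "rainbow_connected 2 G c"
  unfolding rainbow_connected_def
proof (intro ballI impI)
  fix u v assume uv: "u \<in> verts G" "v \<in> verts G" "u \<noteq> v"
  note mid = rainbow_path_mid[OF _ uv]
  have "\<exists>p q. p \<noteq> q \<and> path_between G u v p \<and> rainbow c p \<and> path_between G u v q \<and> rainbow c q
      \<and> inner_verts p \<inter> inner_verts q = {}"
  proof (cases "{u, v} \<in> edges G")
    case True
    then obtain w where "w \<in> rainbow_mids G c u v" using adj uv by blast
    moreover have "path_between G u v [u, v]" "rainbow c [u, v]"
      using True uv by (auto simp: path_between_def rainbow_def)
    ultimately show ?thesis
      using mid[of w] by (intro exI[of _ "[u, v]"] exI[of _ "[u, w, v]"]) (auto simp: inner_verts_def)
  next
    case False
    then obtain w w' where "w \<noteq> w'" "w \<in> rainbow_mids G c u v" "w' \<in> rainbow_mids G c u v"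
      using nonadj uv by blast
    then show ?thesis
      using mid[of w] mid[of w']
      by (intro exI[of _ "[u, w, v]"] exI[of _ "[u, w', v]"]) (auto simp: inner_verts_def)
  qed
  then obtain p q where "p \<noteq> q" "path_between G u v p" "rainbow c p" "path_between G u v q"
    "rainbow c q" "inner_verts p \<inter> inner_verts q = {}" by blast
  then show "\<exists>P. finite P \<and> card P = 2 \<and> (\<forall>p\<in>P. path_between G u v p \<and> rainbow c p) \<and>
      (\<forall>p\<in>P. \<forall>q\<in>P. p \<noteq> q \<longrightarrow> inner_verts p \<inter> inner_verts q = {})"
    by (intro exI[of _ "{p, q}"]) auto
qed

text \<open>\<open>j div 8\<close> selects the unit vector, the three binary digits of \<open>j mod 8\<close> are the first three
  coordinates of the vector of odd weight, and its last coordinate is determined by these.\<close>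

fun heavy :: "nat \<times> nat \<Rightarrow> nat \<times> nat \<Rightarrow> bool" where
  "heavy (m, k) (n, j) \<longleftrightarrow> n = 2 \<and>
     (m = 0 \<and> k = j div 8 \<or>
      m = 1 \<and> (if k < 3 then odd (j div 2 ^ k)
                else even (j mod 2 + j div 2 mod 2 + j div 4 mod 2)))"

definition heavy_edge :: "nat \<times> nat \<Rightarrow> nat \<times> nat \<Rightarrow> bool" where
  "heavy_edge x y \<longleftrightarrow> heavy x y \<or> heavy y x"

text \<open>\<open>heavy\<close> is oriented from a small part to the large one; the existential
  lifts it to unordered edges.\<close>

definition colouring :: "(nat \<times> nat) set \<Rightarrow> nat" where
  "colouring e = (if \<exists>x y. e = {x, y} \<and> heavy x y then 2 else 1)"

lemma colouring_doubleton: "colouring {x, y} = (if heavy_edge x y then 2 else 1)"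
proof -
  have "(\<exists>a b. {x, y} = {a, b} \<and> heavy a b) \<longleftrightarrow> heavy_edge x y"
    unfolding heavy_edge_def doubleton_eq_iff by blast
  then show ?thesis
    by (simp only: colouring_def)
qed

definition vertex_list :: "(nat \<times> nat) list" where
  "vertex_list = map (Pair 0) [0..<2] @ map (Pair 1) [0..<4] @ map (Pair 2) [0..<16]"

text \<open>An executable counterpart of \<open>rainbow_mids\<close>, so that the finitely many
  pairs can be checked by evaluation.\<close>

definition mid_list :: "nat \<times> nat \<Rightarrow> nat \<times> nat \<Rightarrow> (nat \<times> nat) list" where
  "mid_list x y =
     filter (\<lambda>w. fst w \<noteq> fst x \<and> fst w \<noteq> fst y \<and> heavy_edge x w \<noteq> heavy_edge w y) vertex_list"

text \<open>Pairs outside the large part have their midpoints in it: a unit vector always separates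
  the two vertices of the first part, any two coordinates differ in four of the eight odd-weight
  vectors, and across the small parts the two components vary independently.\<close>

lemma length_mid_list:
  "\<forall>x\<in>set vertex_list. \<forall>y\<in>set vertex_list. x \<noteq> y \<longrightarrow>
     (if fst x = fst y then 2 else 1) \<le> length (mid_list x y)"
  by code_simp

lemma verts_multipartite: "verts (complete_multipartite [2, 4, 16]) = set vertex_list"
  by (auto simp: complete_multipartite_def vertex_list_def less_Suc_eq numeral_3_eq_3)

lemma edge_multipartite_iff:
  "{x, y} \<in> edges (complete_multipartite ns) \<longleftrightarrow>
     x \<in> verts (complete_multipartite ns) \<and> y \<in> verts (complete_multipartite ns) \<and> fst x \<noteq> fst y"
proof -
  have "{x, y} \<in> {{a, b} | a b. a \<in> V \<and> b \<in> V \<and> fst a \<noteq> fst b} \<longleftrightarrow>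
      x \<in> V \<and> y \<in> V \<and> fst x \<noteq> fst y" for V :: "(nat \<times> nat) set"
    by (auto simp: doubleton_eq_iff simp del: split_paired_Ex)
  then show ?thesis
    unfolding complete_multipartite_def Let_def fst_conv snd_conv .
qed

text \<open>Lying in a different part makes \<open>w\<close> both distinct from and adjacent to each
  end.\<close>

lemma mid_list_subset:
  assumes "x \<in> set vertex_list" "y \<in> set vertex_list"
  shows "set (mid_list x y) \<subseteq> rainbow_mids (complete_multipartite [2, 4, 16]) colouring x y"
  using assms
  by (auto simp: mid_list_def rainbow_mids_def edge_multipartite_iff verts_multipartite
      colouring_doubleton)

lemma distinct_mid_list: "distinct (mid_list x y)"
  by (auto simp: mid_list_def vertex_list_def distinct_map inj_on_def)

lemma rainbow_connected_colouring:
  "rainbow_connected 2 (complete_multipartite [2, 4, 16]) colouring"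
proof (rule rainbow_2_connectedI)
  let ?G = "complete_multipartite [2, 4, 16]"
  fix u v assume uv: "u \<in> verts ?G" "v \<in> verts ?G" "u \<noteq> v"
  note len = length_mid_list[rule_format, OF uv(1,2)[unfolded verts_multipartite] uv(3)]
  note sub = mid_list_subset[OF uv(1,2)[unfolded verts_multipartite]]
  {
    assume "{u, v} \<in> edges ?G"
    then have "mid_list u v \<noteq> []" using len by (auto split: if_splits)
    then show "\<exists>w. w \<in> rainbow_mids ?G colouring u v"
      using sub hd_in_set by blast
  next
    assume "{u, v} \<notin> edges ?G"
    then have "fst u = fst v" using uv by (simp add: edge_multipartite_iff)
    then have "2 \<le> length (mid_list u v)" using len by simp
    then obtain w w' ws where "mid_list u v = w # w' # ws"
      by (auto simp: numeral_2_eq_2 Suc_le_length_iff)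
    then show "\<exists>w w'. w \<noteq> w' \<and> w \<in> rainbow_mids ?G colouring u v
        \<and> w' \<in> rainbow_mids ?G colouring u v"
      using sub distinct_mid_list[of u v] by (intro exI[of _ w] exI[of _ w']) auto
  }
qed

theorem theorem4p3: "rc 2 (complete_multipartite [2, 4, 16]) = 2"
proof (rule antisym)
  let ?G = "complete_multipartite [2, 4, 16]"
  have "colouring ` edges ?G \<subseteq> {1..2}"
    by (auto simp: colouring_def)
  then have "rc 2 ?G \<le> enat 2"
    unfolding rc_def using rainbow_connected_colouring by (intro Inf_lower) blast
  then show "rc 2 ?G \<le> 2" by (simp add: numeral_eq_enat)
  \<comment> \<open>The lower bound only asks for some pair of distinct vertices.\<close>
  have "(0, 0) \<in> verts ?G" "(0, 1) \<in> verts ?G"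
    by (auto simp: complete_multipartite_def)
  then have "2 \<le> l" if "c ` edges ?G \<subseteq> {1..l}" "rainbow_connected 2 ?G c" for c l
    using rainbow_2_connected_imp_2_colours[OF that] by force
  then show "2 \<le> rc 2 ?G"
    unfolding rc_def by (intro Inf_greatest) (auto simp: numeral_eq_enat)
qed

end
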